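(* Let $J=[0,+\infty)$ and let $A\colon J\to\mathcal{L}(\mathbb{R}^n)$ be of locally bounded variation on $J$ such that $I-\Delta^{-}A(t)$ is invertible for all $t\in(0,+\infty)$ and $I+\Delta^{+}A(t)$ is invertible for all $t\in J$. Let $U$ be the transition matrix of $\frac{dx}{d\tau}=D[A(t)x]$. Then the trivial solution of this equation is globally asymptotically stable if and only if for every $s_0\in J$, $\|U(t,s_0)\|\to 0$ as $t\to+\infty$.
   Context: Here $\Delta^{+}A(t)=A(t^+)-A(t)$, $\Delta^{-}A(t)=A(t)-A(t^-)$. Integrals $\int_a^b \mathrm{d}[A(s)]x(s)$ are Perron–Stieltjes (Kurzweil–Stieltjes) integrals. A solution of $\frac{dx}{d\tau}=D[A(t)x]$ is a function $x$ with $x(b)-x(a)=\int_a^b\mathrm{d}[A(s)]x(s)$ for all $a,b$ in its interval of definition. The transition matrix $U\colon J\times J\to\mathcal{L}(\mathbb{R}^n)$ is the unique matrix function with $U(t,s)=I+\int_s^t\mathrm{d}[A(r)]U(r,s)$; the unique solution with $x(s_0)=x_0$ is $x(t,s_0,x_0)=U(t,s_0)x_0$ for $t\ge s_0$. The trivial solution is stable if for every $s_0\ge0$ and $\varepsilon>0$ there is $\delta=\delta(s_0,\varepsilon)>0$ such that $\|x_0\|<\delta$ implies $\|x(t,s_0,x_0)\|<\varepsilon$ for all $t\ge s_0$. It is globally asymptotically stable if it is stable and for every $s_0\ge 0$ and every $x_0\in\mathbb{R}^n$, $\|x(t,s_0,x_0)\|\to0$ as $t\to+\infty$. *)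

theory Defs
  imports "HOL-Analysis.Analysis"
begin

text \<open>Matrices in L(R^n) are rendered as real^'n^'n; the product d[A] x is matrix product.\<close>

text \<open>Kurzweil--Stieltjes (Perron--Stieltjes) integral of d[A(s)] F(s) over [a,b], a \<le> b:
  limit of Riemann--Stieltjes sums over gauge-fine tagged divisions.\<close>
definition ks_has_integral_on ::
  "(real \<Rightarrow> real^'n^'n) \<Rightarrow> (real \<Rightarrow> real^'n^'n) \<Rightarrow> real^'n^'n \<Rightarrow> real \<Rightarrow> real \<Rightarrow> bool" where
  "ks_has_integral_on A F I a b \<longleftrightarrow>
     (\<forall>e>0. \<exists>\<gamma>. gauge \<gamma> \<and>
        (\<forall>p. p tagged_division_of {a..b} \<and> \<gamma> fine p \<longrightarrow>
             norm ((\<Sum>(x,K)\<in>p. (A (Sup K) - A (Inf K)) ** F x) - I) < e))"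

text \<open>Oriented integral: \<open>\<integral>_a^b = - \<integral>_b^a\<close> when b < a.\<close>
definition ks_has_integral ::
  "(real \<Rightarrow> real^'n^'n) \<Rightarrow> (real \<Rightarrow> real^'n^'n) \<Rightarrow> real^'n^'n \<Rightarrow> real \<Rightarrow> real \<Rightarrow> bool" where
  "ks_has_integral A F I a b \<longleftrightarrow>
     (if a \<le> b then ks_has_integral_on A F I a b else ks_has_integral_on A F (- I) b a)"

text \<open>Bounded variation of a matrix function on [a,b] and local bounded variation on J=[0,\<infinity>).\<close>
definition bv_on :: "(real \<Rightarrow> 'a::real_normed_vector) \<Rightarrow> real \<Rightarrow> real \<Rightarrow> bool" where
  "bv_on A a b \<longleftrightarrow> (\<exists>B. \<forall>d. d division_of {a..b} \<longrightarrow>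
       (\<Sum>K\<in>d. norm (A (Sup K) - A (Inf K))) \<le> B)"

definition loc_bv_J :: "(real \<Rightarrow> 'a::real_normed_vector) \<Rightarrow> bool" where
  "loc_bv_J A \<longleftrightarrow> (\<forall>b\<ge>0. bv_on A 0 b)"

text \<open>One-sided jumps.\<close>
definition jump_plus :: "(real \<Rightarrow> 'a::real_normed_vector) \<Rightarrow> real \<Rightarrow> 'a" where
  "jump_plus A t = Lim (at_right t) A - A t"

definition jump_minus :: "(real \<Rightarrow> 'a::real_normed_vector) \<Rightarrow> real \<Rightarrow> 'a" where
  "jump_minus A t = A t - Lim (at_left t) A"

text \<open>Transition matrix: U(t,s) = I + \<integral>_s^t d[A(r)] U(r,s) for all t, s in J.\<close>
definition transition_matrix ::
  "(real \<Rightarrow> real^'n^'n) \<Rightarrow> (real \<Rightarrow> real \<Rightarrow> real^'n^'n) \<Rightarrow> bool" where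
  "transition_matrix A U \<longleftrightarrow>
     (\<forall>t\<ge>0. \<forall>s\<ge>0. ks_has_integral A (\<lambda>r. U r s) (U t s - mat 1) s t)"

text \<open>The solution through (s0,x0): x(t,s0,x0) = U(t,s0) x0 (t \<ge> s0).\<close>
definition sol :: "(real \<Rightarrow> real \<Rightarrow> real^'n^'n) \<Rightarrow> real \<Rightarrow> real \<Rightarrow> real^'n \<Rightarrow> real^'n" where
  "sol U t s0 x0 = U t s0 *v x0"

definition trivial_stable :: "(real \<Rightarrow> real \<Rightarrow> real^'n^'n) \<Rightarrow> bool" where
  "trivial_stable U \<longleftrightarrow>
     (\<forall>s0\<ge>0. \<forall>\<epsilon>>0. \<exists>\<delta>>0. \<forall>x0. norm x0 < \<delta> \<longrightarrow> (\<forall>t\<ge>s0. norm (sol U t s0 x0) < \<epsilon>))"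

definition trivial_GAS :: "(real \<Rightarrow> real \<Rightarrow> real^'n^'n) \<Rightarrow> bool" where
  "trivial_GAS U \<longleftrightarrow> trivial_stable U \<and>
     (\<forall>s0\<ge>0. \<forall>x0. ((\<lambda>t. norm (sol U t s0 x0)) \<longlongrightarrow> 0) at_top)"

end

theory Submission
  imports Defs
begin

text \<open>Attractivity is pointwise convergence \<open>U(t,s\<^sub>0) x\<^sub>0 \<rightarrow> 0\<close>, which in finite dimension is
  the same as \<open>\<parallel>U(t,s\<^sub>0)\<parallel> \<rightarrow> 0\<close>. So the only real content is that the latter also gives
  stability, i.e. that \<open>\<parallel>U(t,s\<^sub>0)\<parallel>\<close> is bounded on \<open>[s\<^sub>0,\<infinity>)\<close>. Near infinity this follows from
  the convergence; on a compact interval \<open>[s\<^sub>0,T]\<close> it follows because every indefinite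
  Kurzweil--Stieltjes integral \<open>t \<mapsto> \<integral>\<^sub>s\<^sup>t d[A] F\<close> with \<open>A\<close> bounded is bounded: a Saks--Henstock
  argument bounds its increment over any interval that is fine for a suitable gauge by a
  single Riemann--Stieltjes term, and a fine tagged division of \<open>[s,T]\<close> has finitely many
  such intervals.\<close>

definition ks_sum ::
  "(real \<Rightarrow> real^'n^'n) \<Rightarrow> (real \<Rightarrow> real^'n^'n) \<Rightarrow> (real \<times> real set) set \<Rightarrow> real^'n^'n" where
  "ks_sum A F p = (\<Sum>(x,K)\<in>p. (A (Sup K) - A (Inf K)) ** F x)"

lemma bounded_linear_matrix_mult_left: "bounded_linear (\<lambda>X::real^'n^'m. X ** Y)"
  by (auto intro!: linearI simp: linear_conv_bounded_linear[symmetric] vec_eq_iff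
      matrix_matrix_mult_def sum.distrib sum_distrib_left algebra_simps)

lemma tagged_division_Un_real:
  fixes a b c :: real
  assumes "p1 tagged_division_of {a..b}" "p2 tagged_division_of {b..c}" "a \<le> b" "b \<le> c"
  shows "p1 \<union> p2 tagged_division_of {a..c}"
proof -
  have "p1 \<union> p2 tagged_division_of ({a..b} \<union> {b..c})"
    by (rule tagged_division_Un[OF assms(1,2)]) auto
  moreover have "{a..b} \<union> {b..c} = {a..c}" using assms(3,4) by auto
  ultimately show ?thesis by simp
qed

lemma ks_sum_Un:
  fixes a b c :: real
  assumes p1: "p1 tagged_division_of {a..b}" and p2: "p2 tagged_division_of {b..c}"
  shows "ks_sum A F (p1 \<union> p2) = ks_sum A F p1 + ks_sum A F p2"
proof -
  have "(A (Sup K) - A (Inf K)) ** F x = 0" if "(x,K) \<in> p1 \<inter> p2" for x K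
  proof -
    have "x \<in> K" "K \<subseteq> {a..b}" "K \<subseteq> {b..c}"
      using that tagged_division_ofD(2,3)[OF p1] tagged_division_ofD(3)[OF p2] by blast+
    then have "K = {b}" by fastforce
    then show ?thesis by simp
  qed
  then show ?thesis
    unfolding ks_sum_def
    by (intro sum.union_inter_neutral) (auto simp: tagged_division_ofD(1)[OF p1] tagged_division_ofD(1)[OF p2])
qed

lemma ks_has_integral_onE:
  assumes "ks_has_integral_on A F I a b" "e > 0"
  obtains \<gamma> where "gauge \<gamma>"
    "\<And>p. p tagged_division_of {a..b} \<Longrightarrow> \<gamma> fine p \<Longrightarrow> norm (ks_sum A F p - I) < e"
proof -
  obtain \<gamma> where \<gamma>: "gauge \<gamma>"
    "\<forall>p. p tagged_division_of {a..b} \<and> \<gamma> fine p \<longrightarrow> norm (ks_sum A F p - I) < e"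
    using assms(1)[unfolded ks_has_integral_on_def, rule_format, OF assms(2)] unfolding ks_sum_def
    by (elim exE conjE)
  show thesis
    by (rule that[OF \<gamma>(1)]) (simp add: \<gamma>(2))
qed

lemma ks_has_integral_on_fine_sum:
  assumes "ks_has_integral_on A F I a b" "gauge g" "e > 0"
  obtains p where "p tagged_division_of {a..b}" "g fine p" "norm (ks_sum A F p - I) < e"
proof -
  obtain \<gamma> where \<gamma>: "gauge \<gamma>"
    "\<And>p. p tagged_division_of {a..b} \<Longrightarrow> \<gamma> fine p \<Longrightarrow> norm (ks_sum A F p - I) < e"
    using ks_has_integral_onE[OF assms(1,3)] by blast
  obtain p where p: "p tagged_division_of {a..b}" "(\<lambda>x. g x \<inter> \<gamma> x) fine p"
    using fine_division_exists_real[OF gauge_Int[OF assms(2) \<gamma>(1)]] by blast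
  then have "g fine p" "\<gamma> fine p"
    unfolding fine_Int by blast+
  then show thesis
    using that p(1) \<gamma>(2) by blast
qed

text \<open>Saks--Henstock estimate: compare the two \<open>\<gamma>\<close>-fine divisions \<open>p\<^sub>1 \<union> {(x,[u,v])} \<union> p\<^sub>2\<close> and
  \<open>q \<union> p\<^sub>2\<close> of \<open>[s,T]\<close>, where \<open>p\<^sub>1\<close>, \<open>q\<close> and \<open>p\<^sub>2\<close> divide \<open>[s,u]\<close>, \<open>[s,v]\<close> and \<open>[v,T]\<close>.\<close>
lemma ks_indefinite_integral_increment_estimate:
  assumes int: "\<And>t. t \<in> {s..T} \<Longrightarrow> ks_has_integral_on A F (G t) s t"
    and \<gamma>: "gauge \<gamma>"
    and \<gamma>_fine: "\<And>p. p tagged_division_of {s..T} \<Longrightarrow> \<gamma> fine p \<Longrightarrow> norm (ks_sum A F p - G T) < e"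
    and uv: "s \<le> u" "u \<le> v" "v \<le> T" and x: "x \<in> {u..v}" and sub: "{u..v} \<subseteq> \<gamma> x"
  shows "norm ((A v - A u) ** F x - (G v - G u)) \<le> 2 * e"
proof (rule field_le_epsilon)
  fix \<eta> :: real assume "\<eta> > 0"
  then have \<eta>: "\<eta> / 2 > 0" by simp
  have "ks_has_integral_on A F (G u) s u" "ks_has_integral_on A F (G v) s v"
    using int uv by auto
  obtain p1 where p1: "p1 tagged_division_of {s..u}" "\<gamma> fine p1" "norm (ks_sum A F p1 - G u) < \<eta> / 2"
    using ks_has_integral_on_fine_sum[OF \<open>ks_has_integral_on A F (G u) s u\<close> \<gamma> \<eta>] .
  obtain q where q: "q tagged_division_of {s..v}" "\<gamma> fine q" "norm (ks_sum A F q - G v) < \<eta> / 2"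
    using ks_has_integral_on_fine_sum[OF \<open>ks_has_integral_on A F (G v) s v\<close> \<gamma> \<eta>] .
  obtain p2 where p2: "p2 tagged_division_of {v..T}" "\<gamma> fine p2"
    using fine_division_exists_real[OF \<gamma>] by blast
  define m where "m = {(x, {u..v})}"
  have m: "m tagged_division_of {u..v}" "\<gamma> fine m" "ks_sum A F m = (A v - A u) ** F x"
    using x sub uv by (auto simp: m_def ks_sum_def fine_def intro: tagged_division_of_self_real)
  have p1m: "p1 \<union> m tagged_division_of {s..v}"
    using tagged_division_Un_real[OF p1(1) m(1)] uv by simp
  have "p1 \<union> m \<union> p2 tagged_division_of {s..T}" "\<gamma> fine (p1 \<union> m \<union> p2)"
    using tagged_division_Un_real[OF p1m p2(1)] uv p1(2) m(2) p2(2) by (auto intro: fine_Un)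
  then have long: "norm (ks_sum A F p1 + (A v - A u) ** F x + ks_sum A F p2 - G T) < e"
    using \<gamma>_fine ks_sum_Un[OF p1m p2(1)] ks_sum_Un[OF p1(1) m(1)] m(3) by metis
  have "q \<union> p2 tagged_division_of {s..T}" "\<gamma> fine (q \<union> p2)"
    using tagged_division_Un_real[OF q(1) p2(1)] uv q(2) p2(2) by (auto intro: fine_Un)
  then have short: "norm (ks_sum A F q + ks_sum A F p2 - G T) < e"
    using \<gamma>_fine ks_sum_Un[OF q(1) p2(1)] by metis
  have triangle: "norm (a - b + c - d) \<le> norm a + norm b + norm c + norm d" for a b c d :: "real^'n^'n"
    by norm
  have "(A v - A u) ** F x - (G v - G u) =
      (ks_sum A F p1 + (A v - A u) ** F x + ks_sum A F p2 - G T) - (ks_sum A F q + ks_sum A F p2 - G T)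
      + (ks_sum A F q - G v) - (ks_sum A F p1 - G u)"
    by (simp add: algebra_simps)
  then have "norm ((A v - A u) ** F x - (G v - G u)) \<le>
      norm (ks_sum A F p1 + (A v - A u) ** F x + ks_sum A F p2 - G T) + norm (ks_sum A F q + ks_sum A F p2 - G T)
      + norm (ks_sum A F q - G v) + norm (ks_sum A F p1 - G u)"
    by (simp only: triangle)
  then show "norm ((A v - A u) ** F x - (G v - G u)) \<le> 2 * e + \<eta>"
    using long short p1(3) q(3) by linarith
qed

lemma ks_indefinite_integral_increment_le:
  assumes int: "\<And>t. t \<in> {s..T} \<Longrightarrow> ks_has_integral_on A F (G t) s t"
    and \<gamma>: "gauge \<gamma>"
    and \<gamma>_fine: "\<And>p. p tagged_division_of {s..T} \<Longrightarrow> \<gamma> fine p \<Longrightarrow> norm (ks_sum A F p - G T) < e"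
    and "s \<le> u" "v \<le> T" "x \<in> {u..v}" "t \<in> {u..v}" "{u..v} \<subseteq> \<gamma> x"
  shows "norm (G t - G x) \<le> norm ((A t - A x) ** F x) + 2 * e"
proof -
  have "norm ((A t - A x) ** F x - (G t - G x)) \<le> 2 * e"
  proof (cases "x \<le> t")
    case True
    then show ?thesis
      using assms by (intro ks_indefinite_integral_increment_estimate[OF int \<gamma> \<gamma>_fine]) auto
  next
    case False
    have "norm ((A x - A t) ** F x - (G x - G t)) \<le> 2 * e"
      using assms False by (intro ks_indefinite_integral_increment_estimate[OF int \<gamma> \<gamma>_fine]) auto
    moreover have "(A x - A t) ** F x - (G x - G t) = - ((A t - A x) ** F x - (G t - G x))"
      by (simp add: linear_diff[OF bounded_linear.linear[OF bounded_linear_matrix_mult_left]] algebra_simps)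
    ultimately show ?thesis
      by (metis norm_minus_cancel)
  qed
  then show ?thesis
    using norm_triangle_sub[of "G t - G x" "(A t - A x) ** F x"]
      norm_minus_commute[of "G t - G x" "(A t - A x) ** F x"] by linarith
qed

lemma ks_indefinite_integral_norm_le_near_tag:
  fixes A F G :: "real \<Rightarrow> real^'n^'n"
  assumes int: "\<And>t. t \<in> {s..T} \<Longrightarrow> ks_has_integral_on A F (G t) s t"
    and \<gamma>: "gauge \<gamma>"
    and \<gamma>_fine: "\<And>p. p tagged_division_of {s..T} \<Longrightarrow> \<gamma> fine p \<Longrightarrow> norm (ks_sum A F p - G T) < e"
    and A_bound: "\<And>t. t \<in> {s..T} \<Longrightarrow> norm (A t) \<le> M"
    and uv: "s \<le> u" "v \<le> T" "x \<in> {u..v}" "t \<in> {u..v}" "{u..v} \<subseteq> \<gamma> x"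
  shows "norm (G t) \<le> norm (G x) + 2 * M * onorm (\<lambda>X::real^'n^'n. X ** F x) + 2 * e"
proof -
  have "t \<in> {s..T}" "x \<in> {s..T}"
    using uv by auto
  then have "norm (A t - A x) \<le> 2 * M"
    using A_bound[of t] A_bound[of x] norm_triangle_ineq4[of "A t" "A x"] by linarith
  have "norm ((A t - A x) ** F x) \<le> onorm (\<lambda>X::real^'n^'n. X ** F x) * norm (A t - A x)"
    using onorm[OF bounded_linear_matrix_mult_left[of "F x"], of "A t - A x"] by simp
  also have "\<dots> \<le> onorm (\<lambda>X::real^'n^'n. X ** F x) * (2 * M)"
    using \<open>norm (A t - A x) \<le> 2 * M\<close> onorm_pos_le[OF bounded_linear_matrix_mult_left]
    by (rule mult_left_mono)
  finally have "norm ((A t - A x) ** F x) \<le> 2 * M * onorm (\<lambda>X::real^'n^'n. X ** F x)"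
    by (simp add: mult.commute)
  moreover have "norm (G t - G x) \<le> norm ((A t - A x) ** F x) + 2 * e"
    using uv by (intro ks_indefinite_integral_increment_le[OF int \<gamma> \<gamma>_fine]) auto
  ultimately show ?thesis
    using norm_triangle_sub[of "G t" "G x"] by linarith
qed

lemma ks_indefinite_integral_bounded:
  fixes A F G :: "real \<Rightarrow> real^'n^'n"
  assumes int: "\<And>t. t \<in> {s..T} \<Longrightarrow> ks_has_integral_on A F (G t) s t" and "s \<le> T"
    and A_bound: "\<And>t. t \<in> {s..T} \<Longrightarrow> norm (A t) \<le> M"
  shows "\<exists>K. \<forall>t\<in>{s..T}. norm (G t) \<le> K"
proof -
  have int_T: "ks_has_integral_on A F (G T) s T"
    using int \<open>s \<le> T\<close> by simp
  obtain \<gamma> where \<gamma>: "gauge \<gamma>"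
    and \<gamma>_fine: "\<And>p. p tagged_division_of {s..T} \<Longrightarrow> \<gamma> fine p \<Longrightarrow> norm (ks_sum A F p - G T) < 1"
    using ks_has_integral_onE[OF int_T zero_less_one] by blast
  obtain p where p: "p tagged_division_of {s..T}" "\<gamma> fine p"
    using fine_division_exists_real[OF \<gamma>] by blast
  have "0 \<le> M"
    using order_trans[OF norm_ge_zero A_bound[of s]] \<open>s \<le> T\<close> by simp
  define bd where
    "bd = (\<lambda>(x::real, K::real set). norm (G x) + 2 * M * onorm (\<lambda>X::real^'n^'n. X ** F x) + 2 * 1)"
  have "0 \<le> onorm (\<lambda>X::real^'n^'n. X ** F x)" for x
    by (rule onorm_pos_le[OF bounded_linear_matrix_mult_left])
  with \<open>0 \<le> M\<close> have bd_nonneg: "\<forall>y\<in>p. 0 \<le> bd y"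
    by (auto simp: bd_def)
  have "norm (G t) \<le> sum bd p" if t: "t \<in> {s..T}" for t
  proof -
    obtain x K where xK: "(x, K) \<in> p" "t \<in> K"
      using t tagged_division_ofD(6)[OF p(1)] by blast
    obtain u v where K: "K = {u..v}"
      using tagged_division_ofD(4)[OF p(1) xK(1)] by (auto simp: box_real)
    have x: "x \<in> {u..v}" and uv: "{u..v} \<subseteq> {s..T}" "{u..v} \<subseteq> \<gamma> x"
      using tagged_division_ofD(2,3)[OF p(1) xK(1)] p(2) xK(1) K by (auto simp: fine_def)
    then have u: "s \<le> u" and v: "v \<le> T" and t: "t \<in> {u..v}"
      using xK(2) K by auto
    have "norm (G t) \<le> bd (x, K)"
      unfolding bd_def prod.case
      by (rule ks_indefinite_integral_norm_le_near_tag[OF int \<gamma> \<gamma>_fine A_bound u v x t uv(2)])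
    also have "\<dots> \<le> sum bd p"
      using member_le_sum[OF xK(1)] bd_nonneg tagged_division_ofD(1)[OF p(1)] by blast
    finally show ?thesis .
  qed
  then show ?thesis by blast
qed

lemma bv_on_imp_bounded:
  fixes A :: "real \<Rightarrow> 'a::real_normed_vector"
  assumes "bv_on A 0 b"
  shows "\<exists>M. \<forall>t\<in>{0..b}. norm (A t) \<le> M"
proof -
  obtain B where B: "\<And>d. d division_of {0..b} \<Longrightarrow> (\<Sum>K\<in>d. norm (A (Sup K) - A (Inf K))) \<le> B"
    using assms unfolding bv_on_def by blast
  have "norm (A t) \<le> norm (A 0) + B" if t: "t \<in> {0..b}" for t
  proof -
    have "{{0..t}} \<union> {{t..b}} division_of {0..t} \<union> {t..b}"
      by (rule division_disjoint_union[OF division_of_self[of 0 t, unfolded box_real]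
            division_of_self[of t b, unfolded box_real]]) (use t in auto)
    moreover have "{0..t} \<union> {t..b} = {0..b}" using t by auto
    ultimately have d: "{{0..t}, {t..b}} division_of {0..b}" by (simp add: insert_commute)
    have "norm (A (Sup {0..t}) - A (Inf {0..t})) \<le> (\<Sum>K\<in>{{0..t}, {t..b}}. norm (A (Sup K) - A (Inf K)))"
      by (rule member_le_sum) auto
    also have "\<dots> \<le> B" by (rule B[OF d])
    finally have "norm (A t - A 0) \<le> B" using t by simp
    then show ?thesis using norm_triangle_sub[of "A t" "A 0"] by linarith
  qed
  then show ?thesis by blast
qed

lemma transition_matrix_bounded:
  fixes A :: "real \<Rightarrow> real^'n^'n" and U :: "real \<Rightarrow> real \<Rightarrow> real^'n^'n"
  assumes "loc_bv_J A" "transition_matrix A U" "0 \<le> s"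
  shows "\<exists>K. \<forall>t\<in>{s..T}. norm (U t s) \<le> K"
proof (cases "s \<le> T")
  case True
  have "bv_on A 0 T"
    using assms(1,3) True unfolding loc_bv_J_def by simp
  then obtain M where M: "\<forall>t\<in>{0..T}. norm (A t) \<le> M"
    using bv_on_imp_bounded by blast
  have integral: "ks_has_integral_on A (\<lambda>r. U r s) (U t s - mat 1) s t" if "t \<in> {s..T}" for t
    using assms(2,3) that unfolding transition_matrix_def ks_has_integral_def by auto
  have A_bound: "norm (A t) \<le> M" if "t \<in> {s..T}" for t
    using M that assms(3) by auto
  obtain K where K: "\<forall>t\<in>{s..T}. norm (U t s - mat 1) \<le> K"
    using ks_indefinite_integral_bounded[OF integral True A_bound] by blast
  have "norm (U t s) \<le> K + norm (mat 1 :: real^'n^'n)" if "t \<in> {s..T}" for t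
    using K that norm_triangle_sub[of "U t s" "mat 1"] by fastforce
  then show ?thesis by blast
qed auto

lemma matrix_vector_mult_axis_nth: "((M::real^'n^'m) *v axis j 1) $ i = M $ i $ j"
  by (simp add: matrix_vector_mult_def axis_def if_distrib cong: if_cong)

lemma tendsto_onorm_matrix_zero_iff:
  fixes M :: "'a \<Rightarrow> real^'n^'m"
  shows "((\<lambda>t. onorm ((*v) (M t))) \<longlongrightarrow> 0) F \<longleftrightarrow> (\<forall>x. ((\<lambda>t. M t *v x) \<longlongrightarrow> 0) F)"
proof
  assume lim: "((\<lambda>t. onorm ((*v) (M t))) \<longlongrightarrow> 0) F"
  show "\<forall>x. ((\<lambda>t. M t *v x) \<longlongrightarrow> 0) F"
  proof
    fix x :: "real^'n"
    have "\<forall>\<^sub>F t in F. norm (M t *v x) \<le> onorm ((*v) (M t)) * norm x"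
      by (intro always_eventually allI onorm[OF matrix_vector_mul_bounded_linear])
    then show "((\<lambda>t. M t *v x) \<longlongrightarrow> 0) F"
      by (rule Lim_null_comparison[OF _ tendsto_mult_left_zero[OF lim]])
  qed
next
  assume lim: "\<forall>x. ((\<lambda>t. M t *v x) \<longlongrightarrow> 0) F"
  have entry: "((\<lambda>t. M t $ i $ j) \<longlongrightarrow> 0) F" for i j
    using tendsto_vec_nth[OF lim[rule_format, of "axis j 1"], of i]
    by (simp add: matrix_vector_mult_axis_nth)
  have "((\<lambda>t. \<Sum>i\<in>UNIV. \<Sum>j\<in>UNIV. \<bar>M t $ i $ j\<bar>) \<longlongrightarrow> (\<Sum>i\<in>(UNIV::'m set). \<Sum>j\<in>(UNIV::'n set). 0)) F"
    by (intro tendsto_sum tendsto_rabs_zero entry)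
  then have entry_sum: "((\<lambda>t. \<Sum>i\<in>UNIV. \<Sum>j\<in>UNIV. \<bar>M t $ i $ j\<bar>) \<longlongrightarrow> 0) F"
    by simp
  have "\<forall>\<^sub>F t in F. norm (onorm ((*v) (M t))) \<le> (\<Sum>i\<in>UNIV. \<Sum>j\<in>UNIV. \<bar>M t $ i $ j\<bar>)"
  proof (intro always_eventually allI)
    fix t
    have "0 \<le> onorm ((*v) (M t))"
      by (rule onorm_pos_le[OF matrix_vector_mul_bounded_linear])
    then show "norm (onorm ((*v) (M t))) \<le> (\<Sum>i\<in>UNIV. \<Sum>j\<in>UNIV. \<bar>M t $ i $ j\<bar>)"
      using onorm_le_matrix_component_sum[of "M t"] by simp
  qed
  then show "((\<lambda>t. onorm ((*v) (M t))) \<longlongrightarrow> 0) F"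
    by (rule Lim_null_comparison[OF _ entry_sum])
qed

lemma onorm_matrix_le_norm: "onorm ((*v) (M::real^'n^'m)) \<le> real CARD('m) * real CARD('n) * norm M"
proof (rule onorm_le_matrix_component)
  fix i j
  have "\<bar>M $ i $ j\<bar> \<le> norm (M $ i)" by (rule component_le_norm_cart)
  also have "\<dots> \<le> norm M" by (rule Finite_Cartesian_Product.norm_nth_le)
  finally show "\<bar>M $ i $ j\<bar> \<le> norm M" .
qed

lemma onorm_matrix_bounded_on_ray:
  fixes M :: "real \<Rightarrow> real^'n^'m"
  assumes "((\<lambda>t. onorm ((*v) (M t))) \<longlongrightarrow> 0) at_top"
    and "\<And>T. \<exists>K. \<forall>t\<in>{s..T}. norm (M t) \<le> K"
  shows "\<exists>L. \<forall>t\<ge>s. onorm ((*v) (M t)) \<le> L"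
proof -
  obtain N where N: "\<And>t. t \<ge> N \<Longrightarrow> onorm ((*v) (M t)) < 1"
    using order_tendstoD(2)[OF assms(1), of 1] by (auto simp: eventually_at_top_linorder)
  obtain K where K: "\<forall>t\<in>{s..N}. norm (M t) \<le> K"
    using assms(2) by blast
  have "onorm ((*v) (M t)) \<le> max 1 (real CARD('m) * real CARD('n) * K)" if "t \<ge> s" for t
  proof (cases "t \<ge> N")
    case False
    then have "onorm ((*v) (M t)) \<le> real CARD('m) * real CARD('n) * K"
      using onorm_matrix_le_norm[of "M t"] K that by (fastforce intro: order_trans mult_left_mono)
    then show ?thesis by linarith
  qed (use N in fastforce)
  then show ?thesis by blast
qed

lemma trivial_stable_if_onorm_bounded:
  fixes U :: "real \<Rightarrow> real \<Rightarrow> real^'n^'n"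
  assumes "\<And>s0. s0 \<ge> 0 \<Longrightarrow> \<exists>L. \<forall>t\<ge>s0. onorm ((*v) (U t s0)) \<le> L"
  shows "trivial_stable U"
  unfolding trivial_stable_def
proof (intro allI impI)
  fix s0 \<epsilon> :: real assume "s0 \<ge> 0" "\<epsilon> > 0"
  then obtain L where L: "\<And>t. t \<ge> s0 \<Longrightarrow> onorm ((*v) (U t s0)) \<le> L"
    using assms by blast
  have L1: "\<bar>L\<bar> + 1 > 0" by simp
  show "\<exists>\<delta>>0. \<forall>x0. norm x0 < \<delta> \<longrightarrow> (\<forall>t\<ge>s0. norm (sol U t s0 x0) < \<epsilon>)"
  proof (intro exI conjI allI impI)
    show "\<epsilon> / (\<bar>L\<bar> + 1) > 0" using \<open>\<epsilon> > 0\<close> by simp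
    fix x0 :: "real^'n" and t assume x0: "norm x0 < \<epsilon> / (\<bar>L\<bar> + 1)" and "t \<ge> s0"
    have "norm (sol U t s0 x0) \<le> onorm ((*v) (U t s0)) * norm x0"
      unfolding sol_def by (rule onorm[OF matrix_vector_mul_bounded_linear])
    also have "\<dots> \<le> (\<bar>L\<bar> + 1) * norm x0"
      using L[OF \<open>t \<ge> s0\<close>] by (intro mult_right_mono) auto
    also have "\<dots> < \<epsilon>"
      using x0 L1 by (simp add: field_simps)
    finally show "norm (sol U t s0 x0) < \<epsilon>" .
  qed
qed

theorem theorem3p6:
  fixes A :: "real \<Rightarrow> real^'n^'n" and U :: "real \<Rightarrow> real \<Rightarrow> real^'n^'n"
  assumes "loc_bv_J A"
    and "\<forall>t>0. invertible (mat 1 - jump_minus A t)"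
    and "\<forall>t\<ge>0. invertible (mat 1 + jump_plus A t)"
    and "transition_matrix A U"
  shows "trivial_GAS U \<longleftrightarrow>
           (\<forall>s0\<ge>0. ((\<lambda>t. onorm (\<lambda>x. U t s0 *v x)) \<longlongrightarrow> 0) at_top)"
proof -
  have attractive_iff:
    "(\<forall>s0\<ge>0. \<forall>x0. ((\<lambda>t. norm (sol U t s0 x0)) \<longlongrightarrow> 0) at_top) \<longleftrightarrow>
     (\<forall>s0\<ge>0. ((\<lambda>t. onorm ((*v) (U t s0))) \<longlongrightarrow> 0) at_top)"
    by (simp add: sol_def tendsto_norm_zero_iff tendsto_onorm_matrix_zero_iff)
  have "trivial_stable U" if "\<forall>s0\<ge>0. ((\<lambda>t. onorm ((*v) (U t s0))) \<longlongrightarrow> 0) at_top"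
  proof (rule trivial_stable_if_onorm_bounded)
    fix s0 :: real assume "s0 \<ge> 0"
    then show "\<exists>L. \<forall>t\<ge>s0. onorm ((*v) (U t s0)) \<le> L"
      using that transition_matrix_bounded[OF assms(1,4)]
      by (intro onorm_matrix_bounded_on_ray) auto
  qed
  then show ?thesis
    unfolding trivial_GAS_def using attractive_iff by blast
qed

end
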